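(* There is an $O(N\,\mathrm{poly}(D))$-time reduction from a Gap-Max-TropSim$_{\epsilon(D)}$ instance with two sets of $N$ tensors of size $D$ to an instance of the following problem: given two sets of $N$ strings of length $D$, distinguish between the completeness case (some pair $a,b$ has $\mathrm{LCS}(a,b)=\sqrt{D}$) and the soundness case (every pair has $\mathrm{LCS}(a,b)<\sqrt{D}\cdot\epsilon(D)$), with completeness mapped to completeness and soundness to soundness. Consequently, Gap-Max-TropSim$_{\epsilon(D)}$ reduces in $O(N\,\mathrm{poly}(D))$ time to $\epsilon(D)^{-1}$-approximate Closest-LCS-Pair.
   Context: $\mathrm{LCS}(a,b)$ is the length of the longest common subsequence of strings $a,b$. Closest-LCS-Pair: given two sets $A,B$ of $N$ strings, compute $\max_{(a,b)\in A\times B}\mathrm{LCS}(a,b)$. For even $t$, tensors $u,v\in\{0,1\}^{2\times\cdots\times2}$ ($t$ factors, size $D=2^t$) indexed by $i\in\{0,1\}^t$ have tropical similarity $s(u,v)=\mathbb{E}_{i_1}\max_{i_2}\mathbb{E}_{i_3}\cdots\max_{i_t}(u_i\cdot v_i)$, where $\mathbb{E}$ denotes averaging over $\{0,1\}$. Gap-Max-TropSim$_\epsilon$: given two sets $A,B$ of $N$ such tensors, distinguish the case that some pair has $s(a,b)=1$ from the case that every pair has $s(a,b)<\epsilon$. *)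

theory Defs
  imports Complex_Main "HOL-Library.Sublist" "HOL-Library.FuncSet"
begin

section \<open>Word RAM\<close>

text \<open>
  A structured word RAM: registers and a random-access memory hold words of \<open>w\<close> bits, and every
  elementary instruction and every test of a register costs one unit of time.  The program is fixed
  and does not depend on \<open>w\<close>.  There is no transition when an arithmetic result or a constant does
  not fit into a word, so a run witnesses that all words stay below \<open>2 ^ w\<close>.
\<close>

datatype binop = Add | Sub | Mul | Div | Mod | And | Or | Xor

fun eval_binop :: "binop \<Rightarrow> nat \<Rightarrow> nat \<Rightarrow> nat" where
  "eval_binop Add m n = m + n"
| "eval_binop Sub m n = m - n"
| "eval_binop Mul m n = m * n"
| "eval_binop Div m n = m div n"
| "eval_binop Mod m n = m mod n"
| "eval_binop And m n = semiring_bit_operations_class.and m n"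
| "eval_binop Or m n = semiring_bit_operations_class.or m n"
| "eval_binop Xor m n = semiring_bit_operations_class.xor m n"

text \<open>
  Registers are named by natural numbers.  \<open>Load x a\<close> and \<open>Store a x\<close> use the content of register
  \<open>a\<close> as the address; \<open>Write x\<close> appends the content of register \<open>x\<close> to the output.
\<close>

datatype com =
    Const nat nat
  | Op binop nat nat nat
  | Load nat nat
  | Store nat nat
  | Write nat
  | Seq com com
  | IfNZ nat com com
  | WhileNZ nat com

record state =
  reg :: "nat \<Rightarrow> nat"
  mem :: "nat \<Rightarrow> nat"
  outp :: "nat list"

inductive exec :: "nat \<Rightarrow> com \<Rightarrow> state \<Rightarrow> nat \<Rightarrow> state \<Rightarrow> bool" for w :: nat where
  Const: "v < 2 ^ w \<Longrightarrow> exec w (Const x v) s 1 (s\<lparr>reg := (reg s)(x := v)\<rparr>)"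
| Op: "v = eval_binop f (reg s y) (reg s z) \<Longrightarrow> v < 2 ^ w \<Longrightarrow>
    exec w (Op f x y z) s 1 (s\<lparr>reg := (reg s)(x := v)\<rparr>)"
| Load: "exec w (Load x a) s 1 (s\<lparr>reg := (reg s)(x := mem s (reg s a))\<rparr>)"
| Store: "exec w (Store a x) s 1 (s\<lparr>mem := (mem s)(reg s a := reg s x)\<rparr>)"
| Write: "exec w (Write x) s 1 (s\<lparr>outp := outp s @ [reg s x]\<rparr>)"
| Seq: "exec w c s m s' \<Longrightarrow> exec w d s' n s'' \<Longrightarrow> exec w (Seq c d) s (m + n) s''"
| IfTrue: "reg s x \<noteq> 0 \<Longrightarrow> exec w c s n s' \<Longrightarrow> exec w (IfNZ x c d) s (n + 1) s'"
| IfFalse: "reg s x = 0 \<Longrightarrow> exec w d s n s' \<Longrightarrow> exec w (IfNZ x c d) s (n + 1) s'"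
| WhileFalse: "reg s x = 0 \<Longrightarrow> exec w (WhileNZ x c) s 1 s"
| WhileTrue: "reg s x \<noteq> 0 \<Longrightarrow> exec w c s m s' \<Longrightarrow> exec w (WhileNZ x c) s' n s'' \<Longrightarrow>
    exec w (WhileNZ x c) s (m + n + 1) s''"

lemma exec_deterministic:
  "exec w c s n s' \<Longrightarrow> exec w c s m s'' \<Longrightarrow> m = n \<and> s'' = s'"
proof (induction arbitrary: m s'' rule: exec.induct)
  case (Seq c s m1 s1 d n1 s2)
  from Seq.prems obtain a b r where r: "exec w c s a r" "exec w d r b s''" "m = a + b"
    by cases auto
  with Seq.IH(1)[OF r(1)] Seq.IH(2)[of b s''] show ?case by simp
next
  case (IfTrue s x c n s' d)
  from IfTrue.prems obtain a where a: "exec w c s a s''" "m = a + 1"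
    using IfTrue.hyps(1) by cases auto
  with IfTrue.IH[OF a(1)] show ?case by simp
next
  case (IfFalse s x d n s' c)
  from IfFalse.prems obtain a where a: "exec w d s a s''" "m = a + 1"
    using IfFalse.hyps(1) by cases auto
  with IfFalse.IH[OF a(1)] show ?case by simp
next
  case (WhileFalse s x c)
  from WhileFalse.prems show ?case using WhileFalse.hyps by cases auto
next
  case (WhileTrue s x c m1 s1 n1 s2)
  from WhileTrue.prems obtain a b r
    where r: "exec w c s a r" "exec w (WhileNZ x c) r b s''" "m = a + b + 1"
    using WhileTrue.hyps(1) by cases auto
  with WhileTrue.IH(1)[OF r(1)] WhileTrue.IH(2)[of b s''] show ?case by simp
qed (erule exec.cases; simp)+

definition init :: "nat list \<Rightarrow> state" where
  "init ws = \<lparr>reg = (\<lambda>_. 0), mem = (\<lambda>a. if a < length ws then ws ! a else 0), outp = []\<rparr>"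

definition runs :: "nat \<Rightarrow> com \<Rightarrow> nat list \<Rightarrow> nat \<Rightarrow> nat list \<Rightarrow> bool" where
  "runs w P ws T vs \<longleftrightarrow> (\<exists>n s. exec w P (init ws) n s \<and> n \<le> T \<and> outp s = vs)"

text \<open>The usual assumption on the word length: \<open>w \<ge> c * log 2 (S + 2)\<close>, with \<open>S\<close> the input size.\<close>

definition wide :: "nat \<Rightarrow> nat \<Rightarrow> nat \<Rightarrow> bool" where
  "wide c S w \<longleftrightarrow> (S + 2) ^ c \<le> 2 ^ w"


section \<open>Tropical tensors\<close>

type_synonym tensor = "bool list \<Rightarrow> nat"

definition tensors :: "nat \<Rightarrow> tensor set" where
  "tensors t = {i. length i = t} \<rightarrow>\<^sub>E {0, 1}"

text \<open>The flag tells whether the outermost operator is the average or the maximum.\<close>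

fun trop_alt :: "bool \<Rightarrow> nat \<Rightarrow> (bool list \<Rightarrow> real) \<Rightarrow> real" where
  "trop_alt avg 0 f = f []"
| "trop_alt True (Suc t) f =
     (trop_alt False t (\<lambda>i. f (False # i)) + trop_alt False t (\<lambda>i. f (True # i))) / 2"
| "trop_alt False (Suc t) f =
     max (trop_alt True t (\<lambda>i. f (False # i))) (trop_alt True t (\<lambda>i. f (True # i)))"

definition trop_sim :: "nat \<Rightarrow> tensor \<Rightarrow> tensor \<Rightarrow> real" where
  "trop_sim t u v = trop_alt True t (\<lambda>i. real (u i * v i))"

definition trop_instance :: "nat \<Rightarrow> nat \<Rightarrow> tensor set \<Rightarrow> tensor set \<Rightarrow> bool" where
  "trop_instance N t A B \<longleftrightarrow> 1 \<le> N \<and> even t \<and>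
     A \<subseteq> tensors t \<and> B \<subseteq> tensors t \<and> card A = N \<and> card B = N"

definition trop_complete :: "nat \<Rightarrow> tensor set \<Rightarrow> tensor set \<Rightarrow> bool" where
  "trop_complete t A B \<longleftrightarrow> (\<exists>a\<in>A. \<exists>b\<in>B. trop_sim t a b = 1)"

definition trop_sound :: "(nat \<Rightarrow> real) \<Rightarrow> nat \<Rightarrow> tensor set \<Rightarrow> tensor set \<Rightarrow> bool" where
  "trop_sound \<epsilon> t A B \<longleftrightarrow> (\<forall>a\<in>A. \<forall>b\<in>B. trop_sim t a b < \<epsilon> (2 ^ t))"


section \<open>Longest common subsequences\<close>

definition lcs :: "'a list \<Rightarrow> 'a list \<Rightarrow> nat" where
  "lcs a b = Max {length c |c. subseq c a \<and> subseq c b}"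

definition lcs_instance :: "nat \<Rightarrow> nat \<Rightarrow> nat list set \<Rightarrow> nat list set \<Rightarrow> bool" where
  "lcs_instance N D A B \<longleftrightarrow> 1 \<le> N \<and>
     (\<forall>a\<in>A. length a = D) \<and> (\<forall>b\<in>B. length b = D) \<and>
     finite A \<and> finite B \<and> card A = N \<and> card B = N"

definition lcs_complete :: "nat \<Rightarrow> nat list set \<Rightarrow> nat list set \<Rightarrow> bool" where
  "lcs_complete D A B \<longleftrightarrow> (\<exists>a\<in>A. \<exists>b\<in>B. real (lcs a b) = sqrt (real D))"

definition lcs_sound :: "(nat \<Rightarrow> real) \<Rightarrow> nat \<Rightarrow> nat list set \<Rightarrow> nat list set \<Rightarrow> bool" where
  "lcs_sound \<epsilon> D A B \<longleftrightarrow> (\<forall>a\<in>A. \<forall>b\<in>B. real (lcs a b) < sqrt (real D) * \<epsilon> D)"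

definition closest_lcs_pair :: "nat list set \<Rightarrow> nat list set \<Rightarrow> nat" where
  "closest_lcs_pair A B = Max {lcs a b |a b. a \<in> A \<and> b \<in> B}"

definition approx_closest_lcs_pair :: "real \<Rightarrow> nat list set \<Rightarrow> nat list set \<Rightarrow> real \<Rightarrow> bool" where
  "approx_closest_lcs_pair \<alpha> A B r \<longleftrightarrow>
     real (closest_lcs_pair A B) / \<alpha> \<le> r \<and> r \<le> real (closest_lcs_pair A B)"


section \<open>Encodings and reductions\<close>

text \<open>Indices in lexicographic order; tensors are stored in row-major order, one word per entry.\<close>

fun indices :: "nat \<Rightarrow> bool list list" where
  "indices 0 = [[]]"
| "indices (Suc t) = map ((#) False) (indices t) @ map ((#) True) (indices t)"

definition encodes_strings ::
  "nat list \<Rightarrow> nat \<Rightarrow> nat \<Rightarrow> nat list set \<Rightarrow> nat list set \<Rightarrow> bool" where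
  "encodes_strings ws N D A B \<longleftrightarrow> (\<exists>as bs. distinct as \<and> set as = A \<and> distinct bs \<and> set bs = B \<and>
     ws = [N, D] @ concat as @ concat bs)"

definition encodes_tensors ::
  "nat list \<Rightarrow> nat \<Rightarrow> nat \<Rightarrow> tensor set \<Rightarrow> tensor set \<Rightarrow> bool" where
  "encodes_tensors ws N t A B \<longleftrightarrow> (\<exists>as bs. distinct as \<and> set as = A \<and> distinct bs \<and> set bs = B \<and>
     ws = [N, 2 ^ t] @ concat (map (\<lambda>u. map u (indices t)) as)
                     @ concat (map (\<lambda>u. map u (indices t)) bs))"

text \<open>
  On every input with two sets of \<open>N\<close> tensors of size \<open>D = 2 ^ t\<close>, the program \<open>P\<close> outputs, in time
  \<open>C * N * D ^ k\<close>, two sets of \<open>N\<close> strings of length \<open>D\<close> that are related to the input by \<open>Q\<close>.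
\<close>

definition trop_to_lcs ::
  "com \<Rightarrow> (nat \<Rightarrow> nat \<Rightarrow> nat \<Rightarrow> tensor set \<Rightarrow> tensor set \<Rightarrow> nat list set \<Rightarrow> nat list set \<Rightarrow> bool) \<Rightarrow> bool"
  where
  "trop_to_lcs P Q \<longleftrightarrow> (\<exists>c C k. \<forall>N t A B ws w.
     trop_instance N t A B \<longrightarrow> encodes_tensors ws N t A B \<longrightarrow> wide c (N * 2 ^ t) w \<longrightarrow>
     (\<exists>vs A' B'. runs w P ws (C * N * (2 ^ t) ^ k) vs \<and>
        encodes_strings vs N (2 ^ t) A' B' \<and> lcs_instance N (2 ^ t) A' B' \<and>
        Q w N t A B A' B'))"

definition gap_reduction :: "(nat \<Rightarrow> real) \<Rightarrow> com \<Rightarrow> bool" where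
  "gap_reduction \<epsilon> P \<longleftrightarrow> trop_to_lcs P (\<lambda>w N t A B A' B'.
     (trop_complete t A B \<longrightarrow> lcs_complete (2 ^ t) A' B') \<and>
     (trop_sound \<epsilon> t A B \<longrightarrow> lcs_sound \<epsilon> (2 ^ t) A' B'))"

text \<open>
  Every approximate value for the produced instance settles the gap problem by comparison with a
  threshold that depends on \<open>D\<close> only.  This makes sense for arbitrary, even uncomputable, \<open>\<epsilon>\<close>.
\<close>

definition threshold_reduction :: "(nat \<Rightarrow> real) \<Rightarrow> com \<Rightarrow> bool" where
  "threshold_reduction \<epsilon> P \<longleftrightarrow> trop_to_lcs P (\<lambda>w N t A B A' B'.
     \<forall>r. approx_closest_lcs_pair (1 / \<epsilon> (2 ^ t)) A' B' r \<longrightarrow>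
       (trop_complete t A B \<longrightarrow> r \<ge> sqrt (real (2 ^ t)) * \<epsilon> (2 ^ t)) \<and>
       (trop_sound \<epsilon> t A B \<longrightarrow> r < sqrt (real (2 ^ t)) * \<epsilon> (2 ^ t)))"

text \<open>
  The real number \<open>\<epsilon> D\<close> can be compared with a given fraction \<open>m / n\<close> in time \<open>poly D\<close>.
\<close>

definition poly_time_comparable :: "(nat \<Rightarrow> real) \<Rightarrow> bool" where
  "poly_time_comparable \<epsilon> \<longleftrightarrow> (\<exists>E c C k. \<forall>D m n w.
     m \<le> D \<longrightarrow> 1 \<le> n \<longrightarrow> n \<le> D \<longrightarrow> wide c D w \<longrightarrow>
     runs w E [D, m, n] (C * D ^ k) [of_bool (real m / real n \<ge> \<epsilon> D)])"

text \<open>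
  Reduction of the gap problem to the function problem of approximating the optimum, with a single
  query: \<open>P\<close> produces the query and \<open>R\<close> turns any correct answer \<open>r\<close> into a decision, where output
  1 means completeness and output 0 means soundness.
\<close>

definition approx_reduction :: "(nat \<Rightarrow> real) \<Rightarrow> com \<Rightarrow> com \<Rightarrow> bool" where
  "approx_reduction \<epsilon> P R \<longleftrightarrow> (\<exists>C k. trop_to_lcs P (\<lambda>w N t A B A' B'.
     \<forall>r :: nat. approx_closest_lcs_pair (1 / \<epsilon> (2 ^ t)) A' B' (real r) \<longrightarrow>
       (\<exists>b. runs w R [2 ^ t, r] (C * N * (2 ^ t) ^ k) [b] \<and>
         (trop_complete t A B \<longrightarrow> b = 1) \<and> (trop_sound \<epsilon> t A B \<longrightarrow> b = 0))))"

end

theory Submission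
  imports Defs
begin

text \<open>
  If the crossing pairs share no letters, then \<open>lcs (a1 @ a2) (b1 @ b2)\<close> is the sum and
  \<open>lcs (a1 @ a2) (b2 @ b1)\<close> the maximum of \<open>lcs a1 b1\<close> and \<open>lcs a2 b2\<close>. Hence, spelling a
  tensor with a letter of its own for every index, in lexicographic order on the left and with the
  two halves exchanged at every maximum on the right, the LCS equals the tropical similarity times
  \<open>sqrt D\<close>, one factor 2 for each average replaced by a sum. Exchanging the halves maps position
  \<open>j\<close> to \<open>j XOR (D - 1) div 3\<close>, which is a single instruction of the word RAM.
\<close>

unbundle bit_operations_syntax

section \<open>Longest common subsequences of concatenations\<close>

lemma finite_common_subseq_lengths: "finite {length c |c. subseq c a \<and> subseq c b}"
  by (rule finite_subset[of _ "{..length a}"]) (auto dest: list_emb_length)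

lemma length_le_lcs: "subseq c a \<Longrightarrow> subseq c b \<Longrightarrow> length c \<le> lcs a b"
  unfolding lcs_def by (rule Max_ge[OF finite_common_subseq_lengths]) auto

lemma lcs_witness:
  obtains c where "subseq c a" "subseq c b" "length c = lcs a b"
proof -
  have "lcs a b \<in> {length c |c. subseq c a \<and> subseq c b}"
    unfolding lcs_def
    by (rule Max_in[OF finite_common_subseq_lengths]) (use list_emb_Nil in blast)
  then show thesis using that by auto
qed

lemma subseq_set_mono: "subseq c a \<Longrightarrow> set c \<subseteq> set a"
  by (auto dest: list_emb_set)

lemma subseq_append_split:
  assumes "subseq c (a @ b)"
  obtains c1 c2 where "c = c1 @ c2" "subseq c1 a" "subseq c2 b"
  using assms by (auto simp: subseq_append_iff)

text \<open>Cut a common subsequence once along \<open>a1 @ a2\<close> and once along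
  \<open>b1 @ b2\<close>. The letters between the two cuts would lie in both \<open>a1\<close> and
  \<open>b2\<close>, or in both \<open>a2\<close> and \<open>b1\<close>, so the cuts
  coincide.\<close>

lemma lcs_append:
  assumes "set a1 \<inter> set b2 = {}" "set a2 \<inter> set b1 = {}"
  shows "lcs (a1 @ a2) (b1 @ b2) = lcs a1 b1 + lcs a2 b2"
proof (rule antisym)
  obtain c where c: "subseq c (a1 @ a2)" "subseq c (b1 @ b2)" "length c = lcs (a1 @ a2) (b1 @ b2)"
    by (rule lcs_witness)
  obtain c1 c2 where c12: "c = c1 @ c2" "subseq c1 a1" "subseq c2 a2"
    using c(1) by (rule subseq_append_split)
  obtain d1 d2 where d12: "c = d1 @ d2" "subseq d1 b1" "subseq d2 b2"
    using c(2) by (rule subseq_append_split)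
  note sets = c12(2,3)[THEN subseq_set_mono] d12(2,3)[THEN subseq_set_mono]
  have "c1 @ c2 = d1 @ d2" using c12(1) d12(1) by simp
  then obtain e where e: "c1 = d1 @ e \<and> e @ c2 = d2 \<or> c1 @ e = d1 \<and> c2 = e @ d2"
    unfolding append_eq_append_conv2 by blast
  then have "e = []"
  proof (elim disjE conjE)
    assume "c1 = d1 @ e" "e @ c2 = d2"
    then have "set e \<subseteq> set a1 \<inter> set b2" using sets by auto
    then show ?thesis using assms by simp
  next
    assume "c1 @ e = d1" "c2 = e @ d2"
    then have "set e \<subseteq> set a2 \<inter> set b1" using sets by auto
    then show ?thesis using assms by simp
  qed
  with e have "c1 = d1" "c2 = d2" by auto
  then have "length c1 \<le> lcs a1 b1" "length c2 \<le> lcs a2 b2"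
    using c12 d12 by (auto intro: length_le_lcs)
  then show "lcs (a1 @ a2) (b1 @ b2) \<le> lcs a1 b1 + lcs a2 b2"
    using c(3) c12(1) by simp
next
  obtain c1 where c1: "subseq c1 a1" "subseq c1 b1" "length c1 = lcs a1 b1"
    by (rule lcs_witness)
  obtain c2 where c2: "subseq c2 a2" "subseq c2 b2" "length c2 = lcs a2 b2"
    by (rule lcs_witness)
  show "lcs a1 b1 + lcs a2 b2 \<le> lcs (a1 @ a2) (b1 @ b2)"
    using length_le_lcs[OF list_emb_append_mono[OF c1(1) c2(1)] list_emb_append_mono[OF c1(2) c2(2)]]
      c1(3) c2(3) by simp
qed

text \<open>With the blocks in opposite orders, matches between \<open>a1\<close> and
  \<open>b1\<close> cross those between \<open>a2\<close> and \<open>b2\<close>, so a common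
  subsequence uses only one of the two pairs; its first letter decides which.\<close>

lemma lcs_append_swap:
  assumes "set a1 \<inter> set b2 = {}" "set a2 \<inter> set b1 = {}"
  shows "lcs (a1 @ a2) (b2 @ b1) = max (lcs a1 b1) (lcs a2 b2)"
proof (rule antisym)
  obtain c where c: "subseq c (a1 @ a2)" "subseq c (b2 @ b1)" "length c = lcs (a1 @ a2) (b2 @ b1)"
    by (rule lcs_witness)
  obtain c1 c2 where c12: "c = c1 @ c2" "subseq c1 a1" "subseq c2 a2"
    using c(1) by (rule subseq_append_split)
  obtain d1 d2 where d12: "c = d2 @ d1" "subseq d1 b1" "subseq d2 b2"
    using c(2) by (rule subseq_append_split)
  note sets = c12(2,3)[THEN subseq_set_mono] d12(2,3)[THEN subseq_set_mono]
  show "lcs (a1 @ a2) (b2 @ b1) \<le> max (lcs a1 b1) (lcs a2 b2)"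
  proof (cases "c1 = []")
    case True
    then have "set d1 \<subseteq> set a2 \<inter> set b1" using sets c12(1) d12(1) by auto
    then have "d1 = []" using assms by simp
    then have "length c \<le> lcs a2 b2" using True c12 d12 by (auto intro: length_le_lcs)
    then show ?thesis using c(3) by simp
  next
    case False
    have "d2 = []"
    proof (rule ccontr)
      assume "d2 \<noteq> []"
      then have "hd d2 = hd c1" using False c12(1) d12(1) by (metis hd_append)
      then have "hd d2 \<in> set a1 \<inter> set b2"
        using sets \<open>d2 \<noteq> []\<close> False by (metis IntI hd_in_set subsetD)
      then show False using assms by simp
    qed
    then have "set c2 \<subseteq> set a2 \<inter> set b1" using sets c12(1) d12(1) by auto
    then have "c2 = []" using assms by simp
    then have "length c \<le> lcs a1 b1" using \<open>d2 = []\<close> c12 d12 by (auto intro: length_le_lcs)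
    then show ?thesis using c(3) by simp
  qed
next
  obtain c1 where c1: "subseq c1 a1" "subseq c1 b1" "length c1 = lcs a1 b1"
    by (rule lcs_witness)
  obtain c2 where c2: "subseq c2 a2" "subseq c2 b2" "length c2 = lcs a2 b2"
    by (rule lcs_witness)
  show "max (lcs a1 b1) (lcs a2 b2) \<le> lcs (a1 @ a2) (b2 @ b1)"
    using length_le_lcs[of c1 "a1 @ a2" "b2 @ b1"] length_le_lcs[of c2 "a1 @ a2" "b2 @ b1"] c1 c2
    by (auto intro: list_emb_append2 subseq_order.trans[OF _ list_emb_prefix])
qed

lemma lcs_singletons: "lcs [x] [y] = of_bool (x = y)"
proof -
  obtain c where c: "subseq c [x]" "subseq c [y]" "length c = lcs [x] [y]"
    by (rule lcs_witness)
  have "length c \<le> 1" using c(1) list_emb_length by fastforce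
  moreover have "c = []" if "x \<noteq> y"
    using that c(1,2) subseq_set_mono[OF c(1)] subseq_set_mono[OF c(2)] by (cases c) auto
  moreover have "1 \<le> lcs [x] [y]" if "x = y"
    using that length_le_lcs[of "[x]" "[x]" "[y]"] by simp
  ultimately show ?thesis using c(3) by (cases "x = y") auto
qed

section \<open>Strings of tensors\<close>

fun swapped_indices :: "bool \<Rightarrow> nat \<Rightarrow> bool list list" where
  "swapped_indices avg 0 = [[]]"
| "swapped_indices True (Suc t) =
     map ((#) False) (swapped_indices False t) @ map ((#) True) (swapped_indices False t)"
| "swapped_indices False (Suc t) =
     map ((#) True) (swapped_indices True t) @ map ((#) False) (swapped_indices True t)"

lemma set_indices: "set (indices t) = {i. length i = t}"
proof (induction t)
  case (Suc t)
  have "i \<in> (#) False ` {i. length i = t} \<union> (#) True ` {i. length i = t}"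
    if "length i = Suc t" for i
    using that by (cases i; cases "hd i") auto
  with Suc show ?case by auto
qed simp

lemma set_swapped_indices: "set (swapped_indices avg t) = {i. length i = t}"
proof -
  have "set (swapped_indices avg t) = set (indices t)"
    by (induction avg t rule: swapped_indices.induct) auto
  then show ?thesis by (simp add: set_indices)
qed

lemma length_indices: "length (indices t) = 2 ^ t"
  by (induction t) auto

lemma length_swapped_indices: "length (swapped_indices avg t) = 2 ^ t"
  by (induction avg t rule: swapped_indices.induct) auto

text \<open>The two halves differ in the leading index bit, so crossing halves share no letter and
  the rules for concatenations apply at every level. The exponent counts the averages among the
  \<open>t\<close> alternating operators.\<close>

lemma lcs_eq_trop_alt:
  assumes "\<And>i j. length i = t \<Longrightarrow> length j = t \<Longrightarrow> a i = b j \<Longrightarrow> i = j"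
  shows "real (lcs (map a (indices t)) (map b (swapped_indices avg t))) =
    2 ^ ((t + of_bool avg) div 2) * trop_alt avg t (\<lambda>i. of_bool (a i = b i))"
  using assms
proof (induction avg t arbitrary: a b rule: swapped_indices.induct)
  case (1 avg)
  then show ?case by (cases avg) (simp_all add: lcs_singletons)
next
  case (2 t)
  have IH: "real (lcs (map (a \<circ> (#) x) (indices t)) (map (b \<circ> (#) x) (swapped_indices False t))) =
    2 ^ (t div 2) * trop_alt False t (\<lambda>i. of_bool (a (x # i) = b (x # i)))" for x
    using 2(1)[of "a \<circ> (#) x" "b \<circ> (#) x"] 2(3)[of "x # _" "x # _"] by (simp add: comp_def)
  have disj: "set (map (a \<circ> (#) x) (indices t)) \<inter> set (map (b \<circ> (#) y) (swapped_indices False t)) = {}"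
    if "x \<noteq> y" for x y
    using 2(3)[of "x # _" "y # _"] that by (auto simp: set_indices set_swapped_indices)
  \<comment> \<open>Here \<open>(t + 2) div 2 = t div 2 + 1\<close>: the extra factor 2 cancels the
    division by 2 in the average.\<close>
  show ?case
    using lcs_append[OF disj[of False True] disj[of True False]]
    by (simp add: IH field_simps)
next
  case (3 t)
  have IH: "real (lcs (map (a \<circ> (#) x) (indices t)) (map (b \<circ> (#) x) (swapped_indices True t))) =
    2 ^ ((t + 1) div 2) * trop_alt True t (\<lambda>i. of_bool (a (x # i) = b (x # i)))" for x
    using 3(1)[of "a \<circ> (#) x" "b \<circ> (#) x"] 3(3)[of "x # _" "x # _"] by (simp add: comp_def)
  have disj: "set (map (a \<circ> (#) x) (indices t)) \<inter> set (map (b \<circ> (#) y) (swapped_indices True t)) = {}"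
    if "x \<noteq> y" for x y
    using 3(3)[of "x # _" "y # _"] that by (auto simp: set_indices set_swapped_indices)
  \<comment> \<open>The exponent stays \<open>(t + 1) div 2\<close>, and the common factor is
    nonnegative, so it commutes with the maximum.\<close>
  show ?case
    using lcs_append_swap[OF disj[of False True] disj[of True False]]
    by (simp add: IH of_nat_max max_mult_distrib_left)
qed

section \<open>Indices as binary numbers giving their lexicographic position\<close>

fun index_value :: "bool list \<Rightarrow> nat" where
  "index_value [] = 0"
| "index_value (x # i) = of_bool x * 2 ^ length i + index_value i"

lemma index_value_less: "index_value i < 2 ^ length i"
  by (induction i) auto

lemma nth_indices_Suc:
  "j < 2 ^ t \<Longrightarrow> indices (Suc t) ! j = False # indices t ! j"
  "j < 2 ^ t \<Longrightarrow> indices (Suc t) ! (2 ^ t + j) = True # indices t ! j"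
  by (simp_all add: nth_append length_indices)

lemma nth_indices_in: "j < 2 ^ t \<Longrightarrow> length (indices t ! j) = t"
  using nth_mem[of j "indices t"] by (simp add: length_indices set_indices)

lemma index_value_nth_indices: "j < 2 ^ t \<Longrightarrow> index_value (indices t ! j) = j"
proof (induction t arbitrary: j)
  case (Suc t)
  show ?case
  proof (cases "j < 2 ^ t")
    case True
    then show ?thesis using Suc.IH by (simp add: nth_indices_Suc del: indices.simps)
  next
    case False
    then obtain l where "j = 2 ^ t + l" "l < 2 ^ t"
      using Suc.prems by (metis add_less_cancel_left le_add_diff_inverse mult_2 not_le power_Suc)
    then show ?thesis
      using Suc.IH by (simp add: nth_indices_Suc nth_indices_in del: indices.simps)
  qed
qed simp

lemma index_value_inj: "length i = length j \<Longrightarrow> index_value i = index_value j \<Longrightarrow> i = j"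
proof (induction i j rule: list_induct2)
  case (Cons x i y j)
  then show ?case
    using index_value_less[of i] index_value_less[of j] by (cases x; cases y) auto
qed simp

text \<open>
  At an index where both tensors are 1 the two strings carry the same symbol, which occurs nowhere
  else; the fillers 0 and 1 for the entry 0 occur only on the left and on the right, respectively.
\<close>

definition left_string :: "nat \<Rightarrow> tensor \<Rightarrow> nat list" where
  "left_string t u = map (\<lambda>i. u i * (index_value i + 2)) (indices t)"

definition right_string :: "nat \<Rightarrow> tensor \<Rightarrow> nat list" where
  "right_string t v = map (\<lambda>i. v i * (index_value i + 1) + 1) (swapped_indices True t)"

lemma tensors_cases: "u \<in> tensors t \<Longrightarrow> length i = t \<Longrightarrow> u i = 0 \<or> u i = 1"
  by (auto simp: tensors_def PiE_iff)

lemma trop_alt_cong: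
  "(\<And>i. length i = t \<Longrightarrow> f i = g i) \<Longrightarrow> trop_alt avg t f = trop_alt avg t g"
proof (induction avg t f arbitrary: g rule: trop_alt.induct)
  case (2 t f)
  from 2(1)[of "\<lambda>i. g (False # i)"] 2(2)[of "\<lambda>i. g (True # i)"] 2(3) show ?case by simp
next
  case (3 t f)
  from 3(1)[of "\<lambda>i. g (False # i)"] 3(2)[of "\<lambda>i. g (True # i)"] 3(3) show ?case by simp
qed simp

lemma trop_alt_le_one: "(\<And>i. length i = t \<Longrightarrow> f i \<le> 1) \<Longrightarrow> trop_alt avg t f \<le> 1"
proof (induction avg t f rule: trop_alt.induct)
  case (2 t f)
  then have "trop_alt False t (\<lambda>i. f (False # i)) \<le> 1" "trop_alt False t (\<lambda>i. f (True # i)) \<le> 1"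
    by auto
  then show ?case by simp
qed auto

lemma trop_sim_le_one:
  assumes "u \<in> tensors t" "v \<in> tensors t"
  shows "trop_sim t u v \<le> 1"
  unfolding trop_sim_def
proof (rule trop_alt_le_one)
  fix i :: "bool list" assume "length i = t"
  then show "real (u i * v i) \<le> 1"
    using assms[THEN tensors_cases, of i] by auto
qed

lemma sqrt_power_of_two:
  assumes "even t"
  shows "sqrt (2 ^ t) = 2 ^ (t div 2)"
proof -
  have "(2 :: real) ^ t = (2 ^ (t div 2))\<^sup>2"
    using assms by (simp flip: power_mult)
  then show ?thesis by simp
qed

lemma lcs_eq_trop_sim:
  assumes "even t" "u \<in> tensors t" "v \<in> tensors t"
  shows "real (lcs (left_string t u) (right_string t v)) = sqrt (2 ^ t) * trop_sim t u v"
proof -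
  let ?a = "\<lambda>i. u i * (index_value i + 2)" and ?b = "\<lambda>i. v i * (index_value i + 1) + 1"
  have inj: "i = j" if "length i = t" "length j = t" "?a i = ?b j" for i j
    using that tensors_cases[OF assms(2), of i] tensors_cases[OF assms(3), of j]
    by (auto intro: index_value_inj)
  have "(of_bool (?a i = ?b i) :: real) = real (u i * v i)" if "length i = t" for i
    using that tensors_cases[OF assms(2), of i] tensors_cases[OF assms(3), of i] by auto
  then have "trop_alt True t (\<lambda>i. of_bool (?a i = ?b i)) = trop_sim t u v"
    unfolding trop_sim_def by (rule trop_alt_cong)
  \<comment> \<open>For even \<open>t\<close> exactly half of the operators are averages.\<close>
  moreover have "sqrt (2 ^ t) = 2 ^ ((t + of_bool True) div 2)"
    using sqrt_power_of_two[OF \<open>even t\<close>] \<open>even t\<close> by (simp only: of_bool_eq even_succ_div_two)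
  moreover have "real (lcs (left_string t u) (right_string t v)) =
    2 ^ ((t + of_bool True) div 2) * trop_alt True t (\<lambda>i. of_bool (?a i = ?b i))"
    unfolding left_string_def right_string_def by (rule lcs_eq_trop_alt) (rule inj)
  ultimately show ?thesis by (simp only:)
qed

text \<open>Distinct tensors must give distinct strings, since the produced set has to contain
  exactly \<open>N\<close> of them.\<close>

lemma inj_on_left_string: "inj_on (left_string t) (tensors t)"
proof (rule inj_onI)
  fix u v assume uv: "u \<in> tensors t" "v \<in> tensors t" "left_string t u = left_string t v"
  then have "u i = v i" if "length i = t" for i
    using that tensors_cases[OF uv(1) that] tensors_cases[OF uv(2) that]
    by (auto simp: left_string_def set_indices)
  then show "u = v" using uv(1,2) unfolding tensors_def by (intro PiE_ext) auto
qed

lemma inj_on_right_string: "inj_on (right_string t) (tensors t)"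
proof (rule inj_onI)
  fix u v assume uv: "u \<in> tensors t" "v \<in> tensors t" "right_string t u = right_string t v"
  then have "u i = v i" if "length i = t" for i
    using that tensors_cases[OF uv(1) that] tensors_cases[OF uv(2) that]
    by (auto simp: right_string_def set_swapped_indices)
  then show "u = v" using uv(1,2) unfolding tensors_def by (intro PiE_ext) auto
qed

lemma lcs_instance_strings:
  assumes "trop_instance N t A B"
  shows "lcs_instance N (2 ^ t) (left_string t ` A) (right_string t ` B)"
proof -
  have AB: "1 \<le> N" "A \<subseteq> tensors t" "B \<subseteq> tensors t" "card A = N" "card B = N"
    using assms by (auto simp: trop_instance_def)
  then have "finite A" "finite B" by (auto intro!: card_ge_0_finite)
  moreover have "card (left_string t ` A) = N" "card (right_string t ` B) = N"
    using AB by (auto intro!: card_image[THEN trans] inj_on_subset[OF inj_on_left_string]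
        inj_on_subset[OF inj_on_right_string])
  ultimately show ?thesis
    using AB(1) by (auto simp: lcs_instance_def left_string_def right_string_def length_indices
        length_swapped_indices)
qed

section \<open>Positions of the swapped indices\<close>

text \<open>Exchanging the halves of a list of length \<open>2 ^ Suc t\<close> flips the bit of
  weight \<open>2 ^ t\<close> in the position. The mask collects the flipped bits, one for each
  maximum.\<close>

fun swap_mask :: "bool \<Rightarrow> nat \<Rightarrow> nat" where
  "swap_mask avg 0 = 0"
| "swap_mask True (Suc t) = swap_mask False t"
| "swap_mask False (Suc t) = 2 ^ t + swap_mask True t"

lemma swap_mask_less: "swap_mask avg t < 2 ^ t"
  by (induction avg t rule: swap_mask.induct) auto

text \<open>In binary the mask is 0101...01, the geometric sum of the powers of 4 below
  \<open>2 ^ t\<close>.\<close>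

lemma swap_mask_even: "even t \<Longrightarrow> swap_mask True t = (2 ^ t - 1) div 3"
proof -
  have "3 * swap_mask True (2 * h) + 1 = 2 ^ (2 * h)" for h
    by (induction h) auto
  moreover assume "even t"
  ultimately have "2 ^ t = 3 * swap_mask True t + 1" by (metis evenE)
  then show ?thesis by simp
qed

lemma xor_less_power: "x < 2 ^ t \<Longrightarrow> y < 2 ^ t \<Longrightarrow> x XOR y < (2 ^ t :: nat)"
  by (simp flip: take_bit_nat_eq_self_iff)

text \<open>All bits of \<open>x\<close> are below position \<open>t\<close>, so adding
  \<open>2 ^ t\<close> produces no carry.\<close>

lemma power_add_eq_xor:
  assumes "x < 2 ^ t"
  shows "2 ^ t + x = (2 ^ t XOR x :: nat)"
proof -
  have low: "n < t" if "bit x n" for n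
    using that assms by (metis bit_take_bit_iff take_bit_nat_eq_self)
  then have "2 ^ t + x = 2 ^ t OR x"
    by (intro disjunctive_add_eq_or bit_eqI) (auto simp: bit_simps)
  also have "\<dots> = 2 ^ t XOR x"
    using low by (intro bit_eqI) (auto simp: bit_simps)
  finally show ?thesis .
qed

lemma power_add_xor:
  assumes "x < 2 ^ t" "y < 2 ^ t"
  shows "(2 ^ t + x) XOR y = 2 ^ t + (x XOR y :: nat)" "x XOR (2 ^ t + y) = 2 ^ t + (x XOR y)"
    "(2 ^ t + x) XOR (2 ^ t + y) = x XOR y"
proof -
  show "(2 ^ t + x) XOR y = 2 ^ t + (x XOR y :: nat)"
    using assms by (simp add: power_add_eq_xor xor_less_power xor.assoc)
  show "x XOR (2 ^ t + y) = 2 ^ t + (x XOR y)"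
    using assms by (simp add: power_add_eq_xor xor_less_power xor.left_commute)
  have "(2 ^ t XOR x) XOR (2 ^ t XOR y) = (2 ^ t XOR 2 ^ t) XOR (x XOR y)"
    by (simp only: ac_simps)
  then show "(2 ^ t + x) XOR (2 ^ t + y) = x XOR y"
    using assms by (simp add: power_add_eq_xor)
qed

text \<open>The leading bit of \<open>j\<close> selects the half, the others the place inside it.
  The mask leaves the leading bit alone at an average and flips it at a maximum, matching the
  exchange; \<open>power_add_xor\<close> splits this bit off.\<close>

lemma nth_swapped_indices:
  "j < 2 ^ t \<Longrightarrow> swapped_indices avg t ! j = indices t ! (j XOR swap_mask avg t)"
proof (induction avg t arbitrary: j rule: swapped_indices.induct)
  case (2 t)
  show ?case
  proof (cases "j < 2 ^ t")
    case True
    then show ?thesis using 2(1)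
      by (simp add: nth_append length_swapped_indices nth_indices_Suc xor_less_power swap_mask_less
          del: indices.simps)
  next
    case False
    then obtain l where "j = 2 ^ t + l" "l < 2 ^ t"
      using 2(3) by (metis add_less_cancel_left le_add_diff_inverse mult_2 not_le power_Suc)
    then show ?thesis using 2(1)
      by (simp add: nth_append length_swapped_indices nth_indices_Suc xor_less_power swap_mask_less
          power_add_xor del: indices.simps)
  qed
next
  case (3 t)
  show ?case
  proof (cases "j < 2 ^ t")
    case True
    then show ?thesis using 3(1)
      by (simp add: nth_append length_swapped_indices nth_indices_Suc xor_less_power swap_mask_less
          power_add_xor del: indices.simps)
  next
    case False
    then obtain l where "j = 2 ^ t + l" "l < 2 ^ t"
      using 3(3) by (metis add_less_cancel_left le_add_diff_inverse mult_2 not_le power_Suc)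
    then show ?thesis using 3(1)
      by (simp add: nth_append length_swapped_indices nth_indices_Suc xor_less_power swap_mask_less
          power_add_xor del: indices.simps)
  qed
qed simp

section \<open>Running time of programs\<close>

text \<open>The postcondition takes the final state and the part of the time budget that is left.\<close>

definition wp :: "nat \<Rightarrow> com \<Rightarrow> (state \<Rightarrow> nat \<Rightarrow> bool) \<Rightarrow> state \<Rightarrow> nat \<Rightarrow> bool" where
  "wp w c Q s T \<longleftrightarrow> (\<exists>n s'. exec w c s n s' \<and> n \<le> T \<and> Q s' (T - n))"

inductive_cases exec_ConstE: "exec w (Const x v) s n s'"
inductive_cases exec_OpE: "exec w (Op f x y z) s n s'"
inductive_cases exec_LoadE: "exec w (Load x a) s n s'"
inductive_cases exec_StoreE: "exec w (Store a x) s n s'"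
inductive_cases exec_WriteE: "exec w (Write x) s n s'"
inductive_cases exec_SeqE: "exec w (Seq c d) s n s'"

lemma wp_single_step:
  assumes "\<And>n s'. exec w c s n s' \<longleftrightarrow> n = 1 \<and> R \<and> s' = s1"
  shows "wp w c Q s T \<longleftrightarrow> 1 \<le> T \<and> R \<and> Q s1 (T - 1)"
  unfolding wp_def assms by auto

lemma wp_Const:
  "wp w (Const x v) Q s T \<longleftrightarrow> 1 \<le> T \<and> v < 2 ^ w \<and> Q (s\<lparr>reg := (reg s)(x := v)\<rparr>) (T - 1)"
  by (rule wp_single_step) (auto elim: exec_ConstE intro: exec.Const[simplified])

lemma wp_Op:
  "wp w (Op f x y z) Q s T \<longleftrightarrow> 1 \<le> T \<and> eval_binop f (reg s y) (reg s z) < 2 ^ w \<and>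
    Q (s\<lparr>reg := (reg s)(x := eval_binop f (reg s y) (reg s z))\<rparr>) (T - 1)"
  by (rule wp_single_step) (auto elim: exec_OpE intro: exec.Op[simplified])

lemma wp_Load:
  "wp w (Load x a) Q s T \<longleftrightarrow> 1 \<le> T \<and> True \<and> Q (s\<lparr>reg := (reg s)(x := mem s (reg s a))\<rparr>) (T - 1)"
  by (rule wp_single_step) (auto elim: exec_LoadE intro: exec.Load[simplified])

lemma wp_Store:
  "wp w (Store a x) Q s T \<longleftrightarrow> 1 \<le> T \<and> True \<and> Q (s\<lparr>mem := (mem s)(reg s a := reg s x)\<rparr>) (T - 1)"
  by (rule wp_single_step) (auto elim: exec_StoreE intro: exec.Store[simplified])

lemma wp_Write:
  "wp w (Write x) Q s T \<longleftrightarrow> 1 \<le> T \<and> True \<and> Q (s\<lparr>outp := outp s @ [reg s x]\<rparr>) (T - 1)"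
  by (rule wp_single_step) (auto elim: exec_WriteE intro: exec.Write[simplified])

lemma wp_Seq: "wp w (Seq c d) Q s T \<longleftrightarrow> wp w c (wp w d Q) s T"
proof
  assume "wp w (Seq c d) Q s T"
  then show "wp w c (wp w d Q) s T"
    unfolding wp_def by (fastforce elim!: exec_SeqE)
next
  assume "wp w c (wp w d Q) s T"
  then obtain m s' n s'' where e: "exec w c s m s'" "m \<le> T" "exec w d s' n s''" "n \<le> T - m"
    "Q s'' (T - m - n)"
    unfolding wp_def by blast
  then show "wp w (Seq c d) Q s T"
    unfolding wp_def by (intro exI[of _ "m + n"] exI[of _ s'']) (auto intro: exec.Seq)
qed

text \<open>For loops with a known number \<open>n\<close> of rounds: \<open>I k\<close> holds after
  \<open>k\<close> rounds. Each round costs at most \<open>m\<close> plus one for its test, the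
  failing test costs one, and \<open>r\<close> is reserved for what follows.\<close>

lemma wp_WhileNZ:
  assumes "I 0 s"
    and step: "\<And>k s. k < n \<Longrightarrow> I k s \<Longrightarrow> reg s x \<noteq> 0 \<and> wp w c (\<lambda>s' _. I (Suc k) s') s m"
    and exit: "\<And>s. I n s \<Longrightarrow> reg s x = 0"
    and time: "n * (m + 1) + 1 + r \<le> T"
    and post: "\<And>s T. I n s \<Longrightarrow> r \<le> T \<Longrightarrow> Q s T"
  shows "wp w (WhileNZ x c) Q s T"
proof -
  have "\<exists>l s'. exec w (WhileNZ x c) s l s' \<and> l \<le> (n - k) * (m + 1) + 1 \<and> I n s'"
    if "k \<le> n" "I k s" for k s
    using that
  proof (induction arbitrary: s rule: inc_induct)
    case base
    then show ?case using exec.WhileFalse[OF exit] by (intro exI[of _ 1] exI[of _ s]) simp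
  next
    case (step k)
    obtain l s' where l: "exec w c s l s'" "l \<le> m" "I (Suc k) s'" "reg s x \<noteq> 0"
      using assms(2)[OF step(2,4)] unfolding wp_def by blast
    obtain l' s'' where l': "exec w (WhileNZ x c) s' l' s''" "l' \<le> (n - Suc k) * (m + 1) + 1"
      "I n s''"
      using step.IH[OF l(3)] by blast
    have "n - k = Suc (n - Suc k)" using step(2) by simp
    then have "l + l' + 1 \<le> (n - k) * (m + 1) + 1" using l(2) l'(2) by simp
    then show ?case using exec.WhileTrue[OF l(4,1) l'(1)] l'(3) by blast
  qed
  from this[of 0 s] obtain l s' where
    l: "exec w (WhileNZ x c) s l s'" "l \<le> n * (m + 1) + 1" "I n s'"
    using assms(1) by auto
  then have "l \<le> T" "r \<le> T - l" using time by linarith+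
  then show ?thesis unfolding wp_def using l post by blast
qed

lemma runs_iff_wp: "runs w P ws T vs \<longleftrightarrow> wp w P (\<lambda>s _. outp s = vs) (init ws) T"
  by (auto simp: runs_def wp_def)

lemma runs_mono: "runs w P ws T vs \<Longrightarrow> T \<le> T' \<Longrightarrow> runs w P ws T' vs"
  unfolding runs_def using order_trans by blast

section \<open>The reduction\<close>

text \<open>Register 5 is 2 in this loop: both the length of the header \<open>N, D\<close> and the
  summand 2 in the symbol for an entry 1.\<close>

definition left_body :: com where
  "left_body = foldr Seq
    [Op Mod 7 2 0, Op Add 8 2 5, Load 8 8, Op Add 7 7 5, Op Mul 7 8 7, Write 7, Op Add 2 2 4]
    (Op Sub 3 1 2)"

text \<open>\<open>Op Sub 8 2 7\<close> finds the start of the current tensor. If the counter is at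
  position \<open>j\<close> of it, the entry read and the symbol written belong to position
  \<open>j XOR M\<close>, with \<open>M\<close> the mask.\<close>

definition right_body :: com where
  "right_body = foldr Seq
    [Op Mod 7 2 0, Op Sub 8 2 7, Op Xor 7 7 6, Op Add 8 8 7, Op Add 8 8 5, Load 8 8,
     Op Add 7 7 4, Op Mul 7 8 7, Op Add 7 7 4, Write 7, Op Add 2 2 4]
    (Op Sub 3 1 2)"

text \<open>
  Register 0 holds \<open>D\<close>, 1 holds \<open>N * D\<close>, 2 the loop counter, 3 the number of remaining rounds, 4 the
  constant 1, 5 the address of the first tensor of the current set, and 6 the mask \<open>(D - 1) div 3\<close>,
  whose binary digits 1 are at the positions of the maxima; 7 and 8 are scratch.
\<close>

definition reduction :: com where
  "reduction = foldr Seq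
    [Load 7 0, Write 7, Const 4 1, Load 0 4, Write 0, Op Mul 1 7 0, Const 5 2, Op Sub 6 0 4,
     Const 8 3, Op Div 6 6 8, Op Sub 3 1 2, WhileNZ 3 left_body,
     Const 2 0, Op Sub 3 1 2, Op Add 5 5 1]
    (WhileNZ 3 right_body)"

lemmas wp_instr = wp_Seq wp_Const wp_Op wp_Load wp_Store wp_Write

text \<open>\<open>k - k mod D\<close> starts the block of length \<open>D\<close> containing
  \<open>k\<close>, and whole blocks fill \<open>N * D\<close>. Hence the second loop reads only
  entries of the second set.\<close>

lemma block_position_less:
  assumes "k < N * D" "i < (D :: nat)"
  shows "k - k mod D + i < N * D"
proof -
  have "k div D < N" using assms by (simp add: less_mult_imp_div_less)
  then have "(k div D + 1) * D \<le> N * D" by (intro mult_le_mono1) simp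
  moreover have "k - k mod D = k div D * D" by (simp add: minus_mod_eq_div_mult)
  ultimately show ?thesis using assms(2) by (simp add: algebra_simps)
qed

text \<open>Tensors appear here only as flat bit lists. With \<open>S = N * D\<close>, the loops
  cost \<open>9 * S + 1\<close> and \<open>13 * S + 1\<close>, and 14 other instructions give
  \<open>22 * S + 16\<close> in total. No word exceeds \<open>2 * S + 1\<close>, the last address
  read.\<close>

lemma runs_reduction:
  fixes N D :: nat
  defines "M \<equiv> (D - 1) div 3"
  assumes len: "length xs = N * D" "length ys = N * D"
    and bits: "\<And>x. x \<in> set xs \<Longrightarrow> x \<le> 1" "\<And>y. y \<in> set ys \<Longrightarrow> y \<le> 1"
    and pos: "1 \<le> N" "1 \<le> D"
    and mask: "\<And>j. j < D \<Longrightarrow> j XOR M < D"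
    and width: "2 * (N * D) + 3 < 2 ^ w"
  shows "runs w reduction ([N, D] @ xs @ ys) (40 * (N * D))
    ([N, D] @ map (\<lambda>k. xs ! k * (k mod D + 2)) [0..<N * D] @
     map (\<lambda>k. ys ! (k - k mod D + (k mod D XOR M)) * ((k mod D XOR M) + 1) + 1) [0..<N * D])"
    (is "runs w reduction ?ws ?T ([N, D] @ map ?f _ @ map ?g _)")
proof -
  define S where "S = N * D"
  define m where "m = mem (init ?ws)"
  have S: "1 \<le> S" "D \<le> S" using pos by (simp_all add: S_def)
  have w: "2 * S + 3 < 2 ^ w" using width by (simp add: S_def)
  have m0: "m 0 = N" "m (Suc 0) = D" by (simp_all add: m_def init_def)
  have mx: "m (Suc (Suc k)) = xs ! k" "xs ! k \<le> 1" if "k < S" for k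
    using that len bits(1)[of "xs ! k"] by (auto simp: m_def init_def S_def nth_append)
  have my: "m (k + (S + 2)) = ys ! k" "ys ! k \<le> 1" if "k < S" for k
    using that len bits(2)[of "ys ! k"] by (auto simp: m_def init_def S_def nth_append)
  \<comment> \<open>One invariant for both loops: \<open>a\<close> is the first address of the
    current set, \<open>pre\<close> the output before the loop, \<open>f\<close> the symbol at each
    position. Register 3 reaches 0 exactly after \<open>S\<close> rounds.\<close>
  define I where "I = (\<lambda>a pre f k (s :: state). mem s = m \<and> reg s 0 = D \<and> reg s 1 = S \<and> reg s 2 = k \<and>
    reg s 3 = S - k \<and> reg s 4 = 1 \<and> reg s 5 = a \<and> reg s 6 = M \<and>
    outp s = pre @ map f [0..<k])"
  have left: "reg s 3 \<noteq> 0 \<and> wp w left_body (\<lambda>s' _. I 2 pre ?f (Suc k) s') s 8"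
    if "k < S" "I 2 pre ?f k s" for k s pre
  proof -
    have j: "k mod D < D" using pos by simp
    have "xs ! k * (k mod D + 2) \<le> 1 * (k mod D + 2)" by (rule mult_le_mono1) (rule mx(2)[OF that(1)])
    then have "xs ! k * (k mod D + 2) < 2 ^ w" using j w S by simp
    moreover have "S - Suc k < 2 ^ w" using w by linarith
    ultimately show ?thesis using that j w S
      by (simp add: left_body_def wp_instr I_def mx)
  qed
  have right: "reg s 3 \<noteq> 0 \<and> wp w right_body (\<lambda>s' _. I (S + 2) pre ?g (Suc k) s') s 12"
    if "k < S" "I (S + 2) pre ?g k s" for k s pre
  proof -
    define j where "j = k mod D"
    define i where "i = j XOR M"
    define p where "p = k - j + i"
    have j: "j < D" using pos by (simp add: j_def)
    have i: "i < D" using mask[OF j] by (simp add: i_def)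
    have p: "p < S" using block_position_less[OF _ i, of k N] that(1) by (simp add: p_def j_def S_def)
    have "ys ! p * (i + 1) \<le> 1 * (i + 1)" by (rule mult_le_mono1) (rule my(2)[OF p])
    then have y: "ys ! p * (i + 1) + 1 < 2 ^ w" "ys ! p * (i + 1) < 2 ^ w" using i w S by simp_all
    have less: "j < 2 ^ w" "k - j < 2 ^ w" "i < 2 ^ w" "p < 2 ^ w" "p + (S + 2) < 2 ^ w"
      "i + 1 < 2 ^ w" "k + 1 < 2 ^ w" "S - (k + 1) < 2 ^ w"
      using i j p w S that(1) by linarith+
    have kp: "k + i - j = p" by (simp add: p_def j_def)
    have mp: "m (p + (S + 2)) = ys ! p" using my(1)[OF p] .
    have "?g k = ys ! p * (i + 1) + 1" by (simp add: p_def i_def j_def)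
    moreover have "reg s 2 mod reg s 0 = j" using that(2) by (simp add: I_def j_def)
    ultimately show ?thesis using that y less mp kp
      by (simp add: right_body_def wp_instr I_def flip: j_def i_def p_def)
  qed
  have M: "M \<le> D" by (simp add: M_def)
  have exit: "reg s 3 = 0" and out: "outp s = pre @ map f [0..<S]" if "I a pre f S s" for a pre f s
    using that by (simp_all add: I_def)
  define Q where "Q = (\<lambda>(s :: state) (_ :: nat). outp s = ([N, D] @ map ?f [0..<S]) @ map ?g [0..<S])"
  define rest where
    "rest = foldr Seq [Const 2 0, Op Sub 3 1 2, Op Add 5 5 1] (WhileNZ 3 right_body)"
  have second: "wp w (WhileNZ 3 right_body) Q s T"
    if "I (S + 2) ([N, D] @ map ?f [0..<S]) ?g 0 s" "S * 13 + 1 \<le> T" for s T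
    by (rule wp_WhileNZ[where I = "I (S + 2) ([N, D] @ map ?f [0..<S]) ?g" and n = S and m = 12
          and r = 0, OF that(1) right exit])
      (use that(2) out in \<open>simp_all add: Q_def\<close>)
  have first: "wp w (WhileNZ 3 left_body) (wp w rest Q) s T"
    if "I 2 [N, D] ?f 0 s" "S * 9 + 1 + (S * 13 + 4) \<le> T" for s T
  proof (rule wp_WhileNZ[where I = "I 2 [N, D] ?f" and n = S and m = 8 and r = "S * 13 + 4",
        OF that(1) left exit])
    fix s T assume s: "I 2 [N, D] ?f S s" and T: "S * 13 + 4 \<le> T"
    show "wp w rest Q s T"
      using s T w unfolding rest_def foldr.simps comp_def id_def wp_instr
      by (intro conjI second) (auto simp: I_def)
  qed (use that(2) in simp_all)
  have "wp w reduction Q (init ?ws) (40 * S)"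
  proof -
    have lt: "D < 2 ^ w" "S < 2 ^ w" "M < 2 ^ w" "D - Suc 0 < 2 ^ w" "Suc 0 < 2 ^ w"
      "2 < (2::nat) ^ w" "3 < (2::nat) ^ w"
      using w S M by linarith+
    \<comment> \<open>Eleven instructions precede the first loop; with the budget written as eleven
      successors, each of them takes off one.\<close>
    define T where "T = 40 * S - 11"
    have T: "40 * S = Suc (Suc (Suc (Suc (Suc (Suc (Suc (Suc (Suc (Suc (Suc T))))))))))" "S * 22 + 5 \<le> T"
      using S(1) unfolding T_def by linarith+
    define s0 where "s0 = init ?ws"
    have init: "reg s0 = (\<lambda>_. 0)" "outp s0 = []" "mem s0 = m"
      by (simp_all add: s0_def init_def m_def)
    have NS: "N * D = S" "(D - Suc 0) div 3 = M" by (simp_all add: S_def M_def)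
    have split: "reduction = foldr Seq
        [Load 7 0, Write 7, Const 4 1, Load 0 4, Write 0, Op Mul 1 7 0, Const 5 2, Op Sub 6 0 4,
         Const 8 3, Op Div 6 6 8, Op Sub 3 1 2, WhileNZ 3 left_body] rest"
      by (simp add: reduction_def rest_def)
    have "wp w (WhileNZ 3 left_body) (wp w rest Q) s T" if "I 2 [N, D] ?f 0 s" for s
      by (rule first) (use that T(2) in auto)
    then show ?thesis
      unfolding T(1) split s0_def[symmetric] by (simp add: wp_instr I_def init NS m0 lt)
  qed
  then show ?thesis
    by (simp add: runs_iff_wp S_def Q_def)
qed

section \<open>Flat lists cut into blocks of equal length\<close>

lemma length_concat_uniform:
  "(\<And>xs. xs \<in> set xss \<Longrightarrow> length xs = D) \<Longrightarrow> length (concat xss) = length xss * D"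
  by (induction xss) auto

lemma nth_concat_uniform:
  "(\<And>xs. xs \<in> set xss \<Longrightarrow> length xs = D) \<Longrightarrow> q < length xss \<Longrightarrow> j < D \<Longrightarrow>
    concat xss ! (q * D + j) = xss ! q ! j"
proof (induction xss arbitrary: q)
  case (Cons xs xss)
  then show ?case by (cases q) (auto simp: nth_append add.assoc)
qed simp

text \<open>Turns the output of a single loop over the flat counter \<open>q * D + j\<close> into a
  list of strings.\<close>

lemma map_upt_eq_concat:
  assumes "\<And>x. x \<in> set xs \<Longrightarrow> length (F x) = D"
    and "\<And>q j. q < length xs \<Longrightarrow> j < D \<Longrightarrow> f (q * D + j) = F (xs ! q) ! j"
  shows "map f [0..<length xs * D] = concat (map F xs)"
proof (rule nth_equalityI)
  have len: "length ys = D" if "ys \<in> set (map F xs)" for ys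
    using that assms(1) by auto
  show "length (map f [0..<length xs * D]) = length (concat (map F xs))"
    using length_concat_uniform[of "map F xs" D, OF len] by simp
  fix k assume "k < length (map f [0..<length xs * D])"
  then have k: "k < length xs * D" by simp
  then have "0 < D" by (cases D) auto
  then have "k div D < length xs" "k mod D < D"
    using k by (simp_all add: less_mult_imp_div_less)
  then have "f (k div D * D + k mod D) = concat (map F xs) ! (k div D * D + k mod D)"
    using nth_concat_uniform[of "map F xs" D "k div D" "k mod D", OF len]
      assms(2)[of "k div D" "k mod D"] by simp
  then show "map f [0..<length xs * D] ! k = concat (map F xs) ! k"
    using k by simp
qed

lemma runs_reduction_tensors:
  assumes "trop_instance N t A B" "encodes_tensors ws N t A B" "wide 2 (N * 2 ^ t) w"
  shows "\<exists>vs. runs w reduction ws (40 * N * (2 ^ t) ^ 1) vs \<and>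
    encodes_strings vs N (2 ^ t) (left_string t ` A) (right_string t ` B)"
proof -
  define D where "D = (2 :: nat) ^ t"
  define M where "M = (D - 1) div 3"
  define enc where "enc = (\<lambda>us :: tensor list. concat (map (\<lambda>u. map u (indices t)) us))"
  from assms(1) have AB: "1 \<le> N" "even t" "A \<subseteq> tensors t" "B \<subseteq> tensors t" "card A = N" "card B = N"
    by (auto simp: trop_instance_def)
  from assms(2) obtain as bs where ab: "distinct as" "set as = A" "distinct bs" "set bs = B"
    and ws: "ws = [N, D] @ enc as @ enc bs"
    by (auto simp: encodes_tensors_def D_def enc_def)
  have len: "length as = N" "length bs = N"
    using ab AB(5,6) distinct_card by force+
  have M: "M = swap_mask True t" using swap_mask_even[OF AB(2)] by (simp add: M_def D_def)
  have mask: "j XOR M < D" if "j < D" for j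
    using that swap_mask_less[of True t] unfolding M D_def by (rule xor_less_power)
  have enc_len: "length (enc us) = length us * D" for us
    unfolding enc_def by (subst length_concat_uniform[where D = D]) (auto simp: length_indices D_def)
  have enc_nth: "enc us ! (q * D + j) = (us ! q) (indices t ! j)" if "q < length us" "j < D" for us q j
    unfolding enc_def
    by (subst nth_concat_uniform[where D = D]) (use that in \<open>auto simp: length_indices D_def\<close>)
  have enc_bits: "x \<le> 1" if "x \<in> set (enc us)" "set us \<subseteq> tensors t" for us x
    using that tensors_cases[of _ t] by (fastforce simp: enc_def set_indices)
  have val: "index_value (indices t ! j) = j" if "j < D" for j
    using that index_value_nth_indices by (simp add: D_def)
  let ?vs = "[N, D] @ concat (map (left_string t) as) @ concat (map (right_string t) bs)"
  have "map (\<lambda>k. enc as ! k * (k mod D + 2)) [0..<length as * D] = concat (map (left_string t) as)"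
    by (rule map_upt_eq_concat) (simp_all add: left_string_def length_indices enc_nth val flip: D_def)
  moreover have "map (\<lambda>k. enc bs ! (k - k mod D + (k mod D XOR M)) * ((k mod D XOR M) + 1) + 1)
      [0..<length bs * D] = concat (map (right_string t) bs)"
    by (rule map_upt_eq_concat)
      (use mask in \<open>simp_all add: right_string_def length_swapped_indices nth_swapped_indices enc_nth val
        flip: D_def M\<close>)
  moreover have "runs w reduction ([N, D] @ enc as @ enc bs) (40 * (N * D))
    ([N, D] @ map (\<lambda>k. enc as ! k * (k mod D + 2)) [0..<N * D] @
     map (\<lambda>k. enc bs ! (k - k mod D + (k mod D XOR M)) * ((k mod D XOR M) + 1) + 1) [0..<N * D])"
    unfolding M_def
  proof (rule runs_reduction)
    have "2 * (N * D) + 3 < (N * D + 2) ^ 2" by (simp add: power2_eq_square)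
    then show "2 * (N * D) + 3 < 2 ^ w" using assms(3) by (simp add: wide_def D_def)
  qed (use AB ab enc_bits mask in \<open>auto simp: enc_len len D_def M_def\<close>)
  ultimately have "runs w reduction ws (40 * N * (2 ^ t) ^ 1) ?vs"
    by (simp add: ws len D_def mult.assoc)
  moreover have "encodes_strings ?vs N (2 ^ t) (left_string t ` A) (right_string t ` B)"
    unfolding encodes_strings_def
  proof (intro exI conjI)
    show "distinct (map (left_string t) as)" "distinct (map (right_string t) bs)"
      using ab AB(3,4) by (auto simp: distinct_map intro: inj_on_subset[OF inj_on_left_string]
          inj_on_subset[OF inj_on_right_string])
  qed (use ab in \<open>auto simp: D_def\<close>)
  ultimately show ?thesis by blast
qed

section \<open>Correctness of the reductions\<close>

lemma wide_mono: "wide c S w \<Longrightarrow> c' \<le> c \<Longrightarrow> S' \<le> S \<Longrightarrow> wide c' S' w"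
proof -
  assume w: "wide c S w" and le: "c' \<le> c" "S' \<le> S"
  have "(S' + 2) ^ c' \<le> (S + 2) ^ c'" using le by (intro power_mono) auto
  also have "\<dots> \<le> (S + 2) ^ c" using le by (intro power_increasing) auto
  finally show ?thesis using w by (simp add: wide_def)
qed

text \<open>All reductions share the program and the strings, so only the relation \<open>Q\<close>
  remains to be shown. It may ask for its own width exponent \<open>c\<close>; the program itself
  uses 2, hence \<open>max 2 c\<close>.\<close>

lemma trop_to_lcs_reduction:
  assumes "\<And>w N t A B. trop_instance N t A B \<Longrightarrow> wide c (N * 2 ^ t) w \<Longrightarrow>
    Q w N t A B (left_string t ` A) (right_string t ` B)"
  shows "trop_to_lcs reduction Q"
  unfolding trop_to_lcs_def
proof (rule exI[of _ "max 2 c"], rule exI[of _ 40], rule exI[of _ 1], intro allI impI)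
  fix N t A B ws w
  assume *: "trop_instance N t A B" "encodes_tensors ws N t A B" "wide (max 2 c) (N * 2 ^ t) w"
  then have w: "wide 2 (N * 2 ^ t) w" "wide c (N * 2 ^ t) w" by (auto elim: wide_mono)
  obtain vs where "runs w reduction ws (40 * N * (2 ^ t) ^ 1) vs"
    "encodes_strings vs N (2 ^ t) (left_string t ` A) (right_string t ` B)"
    using runs_reduction_tensors[OF *(1,2) w(1)] by blast
  then show "\<exists>vs A' B'. runs w reduction ws (40 * N * (2 ^ t) ^ 1) vs \<and>
      encodes_strings vs N (2 ^ t) A' B' \<and> lcs_instance N (2 ^ t) A' B' \<and> Q w N t A B A' B'"
    using lcs_instance_strings[OF *(1)] assms[OF *(1) w(2)] by blast
qed

lemma gap_reduction_reduction: "gap_reduction \<epsilon> reduction"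
  unfolding gap_reduction_def
proof (rule trop_to_lcs_reduction)
  fix w N t A B assume "trop_instance N t A B"
  then have lcs: "real (lcs (left_string t a) (right_string t b)) = sqrt (2 ^ t) * trop_sim t a b"
    if "a \<in> A" "b \<in> B" for a b
    using that by (intro lcs_eq_trop_sim) (auto simp: trop_instance_def)
  show "(trop_complete t A B \<longrightarrow> lcs_complete (2 ^ t) (left_string t ` A) (right_string t ` B)) \<and>
    (trop_sound \<epsilon> t A B \<longrightarrow> lcs_sound \<epsilon> (2 ^ t) (left_string t ` A) (right_string t ` B))"
    unfolding trop_complete_def lcs_complete_def trop_sound_def lcs_sound_def
    by (auto simp: lcs)
qed

text \<open>Scaling by the positive factor \<open>sqrt (2 ^ t)\<close> preserves the order, so a
  pair with the longest LCS also has the largest similarity. \<open>1 \<le> N\<close> makes both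
  sets nonempty, so the maximum is attained.\<close>

lemma closest_lcs_pair_strings:
  assumes "trop_instance N t A B"
  obtains a b where "a \<in> A" "b \<in> B"
    "real (closest_lcs_pair (left_string t ` A) (right_string t ` B)) = sqrt (2 ^ t) * trop_sim t a b"
    "\<And>a' b'. a' \<in> A \<Longrightarrow> b' \<in> B \<Longrightarrow> trop_sim t a' b' \<le> trop_sim t a b"
proof -
  have AB: "1 \<le> N" "even t" "A \<subseteq> tensors t" "B \<subseteq> tensors t" "card A = N" "card B = N"
    using assms by (auto simp: trop_instance_def)
  define L where "L = {lcs a b |a b. a \<in> left_string t ` A \<and> b \<in> right_string t ` B}"
  have L: "L = (\<lambda>(a, b). lcs (left_string t a) (right_string t b)) ` (A \<times> B)"
    by (auto simp: L_def)
  have "finite A" "finite B" "A \<noteq> {}" "B \<noteq> {}" using AB by (auto intro!: card_ge_0_finite)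
  then have fin: "finite L" "L \<noteq> {}" by (auto simp: L)
  have lcs: "real (lcs (left_string t a) (right_string t b)) = sqrt (2 ^ t) * trop_sim t a b"
    if "a \<in> A" "b \<in> B" for a b
    using that AB by (intro lcs_eq_trop_sim) auto
  obtain a b where ab: "a \<in> A" "b \<in> B" "Max L = lcs (left_string t a) (right_string t b)"
    using Max_in[OF fin] by (auto simp: L)
  have "trop_sim t a' b' \<le> trop_sim t a b" if "a' \<in> A" "b' \<in> B" for a' b'
  proof -
    have "lcs (left_string t a') (right_string t b') \<le> Max L"
      using that by (intro Max_ge fin) (auto simp: L)
    then have "sqrt (2 ^ t) * trop_sim t a' b' \<le> sqrt (2 ^ t) * trop_sim t a b"
      by (simp only: ab(3) of_nat_le_iff flip: lcs[OF that] lcs[OF ab(1,2)])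
    then show ?thesis by simp
  qed
  moreover have "real (closest_lcs_pair (left_string t ` A) (right_string t ` B)) =
      sqrt (2 ^ t) * trop_sim t a b"
    using ab lcs by (simp add: closest_lcs_pair_def flip: L_def)
  ultimately show thesis using ab that by blast
qed

text \<open>The answer lies between \<open>e\<close> times the optimum and the optimum. The optimum
  is \<open>sqrt (2 ^ t)\<close> in the complete case, settled by the lower bound, and below
  \<open>sqrt (2 ^ t) * e\<close> in the sound case, settled by the upper bound. The first claim
  keeps \<open>r\<close> in the range of the comparison program.\<close>

lemma approx_closest_lcs_pair_threshold:
  assumes inst: "trop_instance N t A B"
    and approx: "approx_closest_lcs_pair (1 / e) (left_string t ` A) (right_string t ` B) r"
  shows "r \<le> sqrt (2 ^ t)"
    and "trop_complete t A B \<Longrightarrow> sqrt (2 ^ t) * e \<le> r"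
    and "\<forall>a\<in>A. \<forall>b\<in>B. trop_sim t a b < e \<Longrightarrow> r < sqrt (2 ^ t) * e"
proof -
  obtain a b where ab: "a \<in> A" "b \<in> B"
    and opt: "real (closest_lcs_pair (left_string t ` A) (right_string t ` B)) =
      sqrt (2 ^ t) * trop_sim t a b"
    and max: "\<And>a' b'. a' \<in> A \<Longrightarrow> b' \<in> B \<Longrightarrow> trop_sim t a' b' \<le> trop_sim t a b"
    using closest_lcs_pair_strings[OF inst] by metis
  have le1: "trop_sim t a b \<le> 1"
    using inst ab by (intro trop_sim_le_one) (auto simp: trop_instance_def)
  \<comment> \<open>Dividing by \<open>1 / e\<close> is multiplying by \<open>e\<close>, also for
    \<open>e = 0\<close>, as division by 0 yields 0.\<close>
  have r: "sqrt (2 ^ t) * trop_sim t a b * e \<le> r" "r \<le> sqrt (2 ^ t) * trop_sim t a b"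
    using approx by (simp_all add: approx_closest_lcs_pair_def opt)
  have "sqrt (2 ^ t) * trop_sim t a b \<le> sqrt (2 ^ t) * 1"
    using le1 by (intro mult_left_mono) auto
  then show "r \<le> sqrt (2 ^ t)" using r(2) by linarith
  show "sqrt (2 ^ t) * e \<le> r" if "trop_complete t A B"
  proof -
    have "trop_sim t a b = 1" using that max le1 by (force simp: trop_complete_def)
    then show ?thesis using r(1) by simp
  qed
  show "r < sqrt (2 ^ t) * e" if "\<forall>a\<in>A. \<forall>b\<in>B. trop_sim t a b < e"
  proof -
    have "sqrt (2 ^ t) * trop_sim t a b < sqrt (2 ^ t) * e"
      using that ab by (intro mult_strict_left_mono) auto
    then show ?thesis using r(2) by linarith
  qed
qed

lemma threshold_reduction_reduction: "threshold_reduction \<epsilon> reduction"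
  unfolding threshold_reduction_def
  by (rule trop_to_lcs_reduction)
    (auto simp: trop_sound_def dest: approx_closest_lcs_pair_threshold(2,3))

section \<open>Deciding from an approximate value\<close>

text \<open>Register 1 doubles until its square is \<open>D\<close>, which happens exactly because
  \<open>D\<close> is a power of 4; register 3 is the gap still left.\<close>

definition sqrt_body :: com where
  "sqrt_body = foldr Seq [Op Add 1 1 1, Op Mul 2 1 1] (Op Sub 3 0 2)"

text \<open>
  Appends \<open>sqrt D\<close> to the input and clears the registers, so that another program can be run on the
  extended input as if from its initial state.
\<close>

definition append_sqrt :: com where
  "append_sqrt = foldr Seq
    [Load 0 0, Const 1 1, Op Mul 2 1 1, Op Sub 3 0 2, WhileNZ 3 sqrt_body,
     Const 4 2, Store 4 1, Const 0 0, Const 1 0, Const 2 0, Const 3 0]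
    (Const 4 0)"

text \<open>There are \<open>t div 2\<close> doublings of 4 units each, test included; 12 is 4
  instructions before the loop, the last test and 7 instructions after it. The width leaves room for
  the constant 2 even when \<open>D = 1\<close>.\<close>

lemma wp_append_sqrt:
  assumes "even t" and width: "2 ^ t + 2 \<le> (2 :: nat) ^ w" and T: "T0 + 4 * (t div 2) + 12 \<le> T"
    and post: "\<And>T. T0 \<le> T \<Longrightarrow> Q (init [2 ^ t, r, 2 ^ (t div 2)]) T"
  shows "wp w append_sqrt Q (init [2 ^ t, r]) T"
proof -
  define h where "h = t div 2"
  define m where "m = mem (init [2 ^ t, r])"
  have pow: "(2 :: nat) ^ t = 4 ^ h"
    using assms(1) by (auto simp: h_def power_mult elim!: evenE)
  \<comment> \<open>The registers from 4 on must stay 0 so that clearing 0 to 4 afterwards yields a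
    genuine initial state; register 2 is scratch.\<close>
  define I where "I = (\<lambda>k (s :: state). mem s = m \<and> outp s = [] \<and> reg s 0 = 2 ^ t \<and> reg s 1 = 2 ^ k \<and>
    reg s 3 = 2 ^ t - 4 ^ k \<and> (\<forall>i\<ge>4. reg s i = 0))"
  have step: "reg s 3 \<noteq> 0 \<and> wp w sqrt_body (\<lambda>s' _. I (Suc k) s') s 3" if "k < h" "I k s" for k s
  proof -
    have le: "(4 :: nat) ^ Suc k \<le> 2 ^ t" unfolding pow using that(1) by (intro power_increasing) auto
    moreover have "(2 :: nat) ^ Suc k \<le> 4 ^ Suc k" by (rule power_mono) auto
    moreover have "(2 :: nat) ^ k * 2 ^ k = 4 ^ k" by (simp flip: power_mult_distrib)
    moreover have "4 ^ k < (2 :: nat) ^ t" using le by (rule less_le_trans[rotated]) simp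
    ultimately show ?thesis using that(2) width
      by (auto simp: sqrt_body_def wp_instr I_def mult_2 algebra_simps)
  qed
  have final: "wp w (foldr Seq [Const 4 2, Store 4 1, Const 0 0, Const 1 0, Const 2 0, Const 3 0]
      (Const 4 0)) Q s T" if "I h s" and T: "T0 + 7 \<le> T" for s T
  proof -
    have "s\<lparr>mem := m(2 := 2 ^ h), reg := (reg s)(0 := 0, Suc 0 := 0, 2 := 0, 3 := 0, 4 := 0)\<rparr> =
        init [2 ^ t, r, 2 ^ h]" (is "?s = _")
    proof (rule state.equality)
      show "reg ?s = reg (init [2 ^ t, r, 2 ^ h])"
        using that(1) by (auto simp: I_def init_def fun_eq_iff)
      show "mem ?s = mem (init [2 ^ t, r, 2 ^ h])"
        by (auto simp: init_def m_def fun_eq_iff less_Suc_eq numeral_2_eq_2)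
    qed (use that(1) in \<open>auto simp: I_def init_def\<close>)
    moreover have "2 < (2 :: nat) ^ w" using width by (rule less_le_trans[rotated]) simp
    moreover obtain d where "T = T0 + 7 + d" using T le_Suc_ex by blast
    then have "T = Suc (Suc (Suc (Suc (Suc (Suc (Suc (T0 + d)))))))" by simp
    ultimately show ?thesis using that(1) post[of "T0 + d"]
      by (simp add: wp_instr I_def flip: h_def)
  qed
  have loop: "wp w (WhileNZ 3 sqrt_body) (wp w (foldr Seq
      [Const 4 2, Store 4 1, Const 0 0, Const 1 0, Const 2 0, Const 3 0] (Const 4 0)) Q) s T"
    if "I 0 s" "h * 4 + 1 + (T0 + 7) \<le> T" for s T
    by (rule wp_WhileNZ[where I = I and n = h and m = 3 and r = "T0 + 7"])
      (use that step final in \<open>auto simp: I_def pow\<close>)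
  have "1 < (2 :: nat) ^ w" "2 ^ t < (2 :: nat) ^ w" "2 ^ t - 1 < (2 :: nat) ^ w" using width by linarith+
  then show ?thesis
    unfolding append_sqrt_def foldr.simps comp_def id_def wp_instr
    by (intro conjI loop[unfolded foldr.simps comp_def id_def wp_instr])
      (use T in \<open>auto simp: I_def init_def m_def h_def\<close>)
qed

text \<open>Testing \<open>r\<close> against the threshold means comparing
  \<open>\<epsilon> D\<close> with the fraction \<open>r / n\<close>, where
  \<open>n = sqrt D\<close> is a natural number for even \<open>t\<close>. The comparison program
  does this once \<open>n\<close> is appended to its input.\<close>

lemma approx_reduction_reduction:
  assumes "poly_time_comparable \<epsilon>"
  shows "\<exists>R. approx_reduction \<epsilon> reduction R"
proof -
  obtain E c C k where E: "\<And>D m n w. m \<le> D \<Longrightarrow> 1 \<le> n \<Longrightarrow> n \<le> D \<Longrightarrow> wide c D w \<Longrightarrow>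
      runs w E [D, m, n] (C * D ^ k) [of_bool (real m / real n \<ge> \<epsilon> D)]"
    using assms unfolding poly_time_comparable_def by metis
  have "approx_reduction \<epsilon> reduction (Seq append_sqrt E)"
    unfolding approx_reduction_def
  \<comment> \<open>The overhead \<open>4 * (t div 2) + 12\<close> is at most \<open>16 * D\<close>
    because \<open>t \<le> D\<close>; the exponent \<open>Suc k\<close> absorbs it even for
    \<open>k = 0\<close>. Width exponent 1 serves the computation of the root.\<close>
  proof (rule exI[of _ "C + 16"], rule exI[of _ "Suc k"], rule trop_to_lcs_reduction[where c = "max 1 c"],
      intro allI impI)
    fix w N t A B r
    assume inst: "trop_instance N t A B" and wide: "wide (max 1 c) (N * 2 ^ t) w"
      and approx: "approx_closest_lcs_pair (1 / \<epsilon> (2 ^ t)) (left_string t ` A) (right_string t ` B) (real r)"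
    define D where "D = (2 :: nat) ^ t"
    define n where "n = (2 :: nat) ^ (t div 2)"
    have N: "1 \<le> N" "even t" using inst by (auto simp: trop_instance_def)
    have n: "1 \<le> n" "n \<le> D" by (auto simp: n_def D_def intro: power_increasing)
    have sqrt: "sqrt (2 ^ t) = real n" using sqrt_power_of_two[OF N(2)] by (simp add: n_def)
    note thr = approx_closest_lcs_pair_threshold[OF inst approx, unfolded sqrt]
    have "r \<le> D" using thr(1) n by simp
    have w: "wide c D w" "wide 1 D w" using wide N by (auto elim!: wide_mono simp: D_def)
    let ?b = "of_bool (real r / real n \<ge> \<epsilon> D) :: nat"
    have "wp w (Seq append_sqrt E) (\<lambda>s _. outp s = [?b]) (init [D, r]) (C * D ^ k + 4 * (t div 2) + 12)"
      unfolding wp_Seq D_def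
    proof (rule wp_append_sqrt[where ?T0.0 = "C * D ^ k"])
      show "wp w E (\<lambda>s _. outp s = [of_bool (real r / real n \<ge> \<epsilon> (2 ^ t))])
          (init [2 ^ t, r, 2 ^ (t div 2)]) T" if "C * D ^ k \<le> T" for T
        using runs_mono[OF E[OF \<open>r \<le> D\<close> n w(1)] that] unfolding runs_iff_wp
        by (simp add: D_def n_def)
    qed (use N w(2) in \<open>auto simp: D_def wide_def\<close>)
    then have run: "runs w (Seq append_sqrt E) [D, r] (C * D ^ k + 4 * (t div 2) + 12) [?b]"
      by (simp add: runs_iff_wp)
    have D: "1 \<le> D" "t \<le> D" using less_exp[of t] by (simp_all add: D_def)
    have "C * D ^ k + 4 * (t div 2) + 12 \<le> C * D ^ Suc k + 16 * D ^ Suc k"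
    proof -
      have "D ^ k \<le> D ^ Suc k" using D(1) by simp
      then have "C * D ^ k \<le> C * D ^ Suc k" by (rule mult_le_mono2)
      moreover have "D \<le> D ^ Suc k" using D(1) by simp
      ultimately show ?thesis using D by linarith
    qed
    also have "\<dots> \<le> N * ((C + 16) * D ^ Suc k)"
      using N(1) by (simp add: algebra_simps add_mono)
    also have "\<dots> = (C + 16) * N * (2 ^ t) ^ Suc k" by (simp add: D_def ac_simps)
    finally have "runs w (Seq append_sqrt E) [2 ^ t, r] ((C + 16) * N * (2 ^ t) ^ Suc k) [?b]"
      using runs_mono[OF run] by (simp add: D_def)
    moreover have "trop_complete t A B \<longrightarrow> ?b = 1" "trop_sound \<epsilon> t A B \<longrightarrow> ?b = 0"
      using thr(2,3) n(1) by (auto simp: trop_sound_def D_def field_simps)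
    ultimately show "\<exists>b. runs w (Seq append_sqrt E) [2 ^ t, r] ((C + 16) * N * (2 ^ t) ^ Suc k) [b] \<and>
        (trop_complete t A B \<longrightarrow> b = 1) \<and> (trop_sound \<epsilon> t A B \<longrightarrow> b = 0)"
      by blast
  qed
  then show ?thesis by blast
qed

theorem theorem6p2:
  fixes \<epsilon> :: "nat \<Rightarrow> real"
  shows "\<exists>P. gap_reduction \<epsilon> P \<and> threshold_reduction \<epsilon> P \<and>
           (poly_time_comparable \<epsilon> \<longrightarrow> (\<exists>R. approx_reduction \<epsilon> P R))"
  using gap_reduction_reduction threshold_reduction_reduction approx_reduction_reduction by blast

end
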